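(* Let $c>0$. For $\ell>0$ let $\mathcal A(\ell),\mathcal B(\ell)$ be the transition probabilities specified below, and let $\mathrm{acc}(\ell)$ and $\mathrm{eff}(\ell)$ be the acceptance rate and efficiency function defined in the context. Then: (i) In the reversible case, where $\mathcal A(\ell)=\mathcal B(\ell)=\Phi(-c\ell/2)$, the function $\mathrm{eff}$ on $(0,\infty)$ is maximised at $\ell=\ell_*\doteq 2.38/c$, and then $\mathcal A(\ell_* )\doteq 0.117$, $\mathrm{acc}(\ell_* )=2\mathcal A(\ell_* )\doteq 0.234$ and $\mathrm{eff}(\ell_* )\doteq 1.33/c^2$. (ii) In the non-reversible case, where $\mathcal B(\ell)\equiv 0$ and $\mathcal A(\ell)=2\Phi(-c\ell/2)$, the function $\mathrm{eff}$ on $(0,\infty)$ is maximised at $\ell=\ell_{**}\doteq 1.73/c$, and then $\mathrm{acc}(\ell_{**})\doteq 0.387$ and $\mathrm{eff}(\ell_{**})\doteq 1.89/c^2$. Here $\doteq$ means equality after rounding to the displayed digits; that is, $|c\ell_*-2.38|\le 0.005$, $|\mathcal A(\ell_* )-0.117|\le 0.0005$, $|\mathrm{acc}(\ell_* )-0.234|\le 0.0005$, $|c^2\mathrm{eff}(\ell_* )-1.33|\le 0.005$, $|c\ell_{**}-1.73|\le 0.005$, $|\mathrm{acc}(\ell_{**})-0.387|\le 0.0005$, $|c^2\mathrm{eff}(\ell_{**})-1.89|\le 0.005$.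
   Context: $\Phi(z)=\int_{-\infty}^z\frac{1}{\sqrt{2\pi}}e^{-u^2/2}\,du$ is the standard normal distribution function. Model. A tempering algorithm's temperature index (in the limit of dimension $d\to\infty$, where proposed moves at scaling $\ell$ are accepted with probability $2\Phi(-c\ell/2)$ for a problem-dependent constant $c>0$) is modelled by the Markov chain on $\mathbb{Z}\times\{+,-\}$ that from $(i,+)$ moves to $(i+1,+)$, $(i-1,+)$, $(i,-)$ with probabilities $\mathcal A(\ell),\mathcal B(\ell),\mathcal C(\ell)$ respectively, and from $(i,-)$ moves to $(i-1,-)$, $(i+1,-)$, $(i,+)$ with probabilities $\mathcal A(\ell),\mathcal B(\ell),\mathcal C(\ell)$ respectively, where $\mathcal C(\ell)=1-\mathcal A(\ell)-\mathcal B(\ell)$, and adjacent integers are regarded as being at distance $\ell$. In both the reversible and non-reversible cases define $\mathrm{acc}(\ell):=\mathcal A(\ell)+\mathcal B(\ell)$ and $\mathrm{eff}(\ell):=\ell^2v(\ell)$, where $$v(\ell):=\frac{(\mathcal A(\ell)-\mathcal B(\ell))^2}{\mathcal C(\ell)}+\mathcal A(\ell)+\mathcal B(\ell).$$ *)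

theory Defs
  imports "HOL-Probability.Probability"
begin

definition Phi :: "real \<Rightarrow> real" where
  "Phi z = (LBINT u:{..z}. std_normal_density u)"

text \<open>
  The functions below take as arguments the transition probabilities, as functions of the
  scaling \<open>l\<close>, of the chain on \<open>\<int> \<times> {+,-}\<close>: from \<open>(i,+)\<close> it moves to
  \<open>(i+1,+)\<close>, \<open>(i-1,+)\<close>, \<open>(i,-)\<close>, and from \<open>(i,-)\<close> to \<open>(i-1,-)\<close>, \<open>(i+1,-)\<close>, \<open>(i,+)\<close>,
  with probabilities \<open>A l\<close>, \<open>B l\<close>, \<open>flip A B l\<close> respectively.
\<close>

definition flip :: "(real \<Rightarrow> real) \<Rightarrow> (real \<Rightarrow> real) \<Rightarrow> real \<Rightarrow> real" where
  "flip A B l = 1 - A l - B l"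

definition acc_rate :: "(real \<Rightarrow> real) \<Rightarrow> (real \<Rightarrow> real) \<Rightarrow> real \<Rightarrow> real" where
  "acc_rate A B l = A l + B l"

definition vol :: "(real \<Rightarrow> real) \<Rightarrow> (real \<Rightarrow> real) \<Rightarrow> real \<Rightarrow> real" where
  "vol A B l = (A l - B l)\<^sup>2 / flip A B l + A l + B l"

definition eff :: "(real \<Rightarrow> real) \<Rightarrow> (real \<Rightarrow> real) \<Rightarrow> real \<Rightarrow> real" where
  "eff A B l = l\<^sup>2 * vol A B l"

definition A_rev :: "real \<Rightarrow> real \<Rightarrow> real" where
  "A_rev c l = Phi (- c * l / 2)"

definition B_rev :: "real \<Rightarrow> real \<Rightarrow> real" where
  "B_rev c l = Phi (- c * l / 2)"

definition A_nonrev :: "real \<Rightarrow> real \<Rightarrow> real" where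
  "A_nonrev c l = 2 * Phi (- c * l / 2)"

definition B_nonrev :: "real \<Rightarrow> real \<Rightarrow> real" where
  "B_nonrev c l = 0"

end

theory Submission
  imports Defs "HOL-Real_Asymp.Real_Asymp"
begin

text \<open>
  In the variable \<open>x = c l / 2\<close> both efficiencies are, up to the factor \<open>1 / c\<^sup>2\<close>, explicit functions
  of \<open>x\<close> and \<open>\<Phi>(-x)\<close>. Up to a positive factor their derivatives are
  \<open>2 \<Phi>(-x) - x \<phi>(x)\<close> and \<open>2 \<Phi>(-x) (1 - 2 \<Phi>(-x)) - x \<phi>(x)\<close>, and the derivatives of these are
  \<open>\<phi>(x)\<close> times \<open>x\<^sup>2 - 3\<close> and \<open>x\<^sup>2 - 3 + 8 \<Phi>(-x)\<close>. The first is
  positive near \<open>0\<close>, decreases and then increases to its limit \<open>0\<close>; the second vanishes at \<open>0\<close>, increases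
  and then decreases to a negative value, and it lies below the first. Hence each efficiency
  increases up to, and decreases after, a short interval containing its maximiser. The intervals
  \<open>[1.19, 1.191]\<close> and \<open>[0.8642, 0.8643]\<close> are certified by truncating the alternating series of \<open>exp\<close>
  and of \<open>\<Phi>\<close>, and they are short enough to determine all the displayed digits.
\<close>

subsection \<open>The standard normal distribution function\<close>

lemma Phi_eq_cdf: "Phi z = cdf std_normal_distribution z"
proof -
  interpret real_distribution std_normal_distribution
    by (rule real_dist_normal_dist)
  have "cdf std_normal_distribution z = (\<integral>x. indicator {..z} x \<partial>std_normal_distribution)"
    by (simp add: cdf_def)
  also have "\<dots> = Phi z"
    unfolding Phi_def set_lebesgue_integral_def
    by (subst integral_density) (auto simp: mult.commute)
  finally show ?thesis ..
qed

lemma Phi_at_bot: "(Phi \<longlongrightarrow> 0) at_bot"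
proof -
  interpret real_distribution std_normal_distribution
    by (rule real_dist_normal_dist)
  show ?thesis using cdf_lim_at_bot by (simp add: Phi_eq_cdf[abs_def])
qed

lemma Phi_at_top: "(Phi \<longlongrightarrow> 1) at_top"
proof -
  interpret real_distribution std_normal_distribution
    by (rule real_dist_normal_dist)
  show ?thesis using cdf_lim_at_top_prob by (simp add: Phi_eq_cdf[abs_def])
qed

lemma DERIV_std_normal_density:
  "(std_normal_density has_real_derivative - x * std_normal_density x) (at x)"
  unfolding std_normal_density_def[abs_def]
  by (auto intro!: derivative_eq_intros simp: field_simps)

text \<open>The domain of integration is unbounded, so the constant mass up to \<open>z - 1\<close>
  is split off and the fundamental theorem of calculus is applied to the compact remainder.\<close>

lemma DERIV_Phi: "(Phi has_real_derivative std_normal_density z) (at z)"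
proof -
  let ?a = "z - 1" and ?b = "z + 1"
  have cont: "continuous_on A std_normal_density" for A
    using DERIV_isCont[OF DERIV_std_normal_density] continuous_at_imp_continuous_on by blast
  have int: "set_integrable lborel A std_normal_density" if "A \<in> sets borel" for A
    using integrable_mult_indicator[of A lborel std_normal_density]
      integrable_std_normal_moment[of 0] that by (simp add: set_integrable_def)
  have eq: "Phi x = Phi ?a + integral {?a..x} std_normal_density" if "x \<in> {?a<..<?b}" for x
  proof -
    have "{..x} = {..?a} \<union> {?a<..x}" using that by auto
    moreover have "{..?a} \<inter> {?a<..x} = {}" by auto
    ultimately have "Phi x = Phi ?a + (LBINT u:{?a<..x}. std_normal_density u)"
      unfolding Phi_def by (simp only: set_integral_Un int borel_closed closed_atMost
        greaterThanAtMost_borel)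
    also have "(LBINT u:{?a<..x}. std_normal_density u) = integral {?a<..x} std_normal_density"
      by (intro set_borel_integral_eq_integral int) auto
    also have "\<dots> = integral {?a..x} std_normal_density"
      by (rule integral_spike_set) (auto intro: negligible_subset[of "{?a}"])
    finally show ?thesis .
  qed
  have "((\<lambda>x. integral {?a..x} std_normal_density) has_real_derivative std_normal_density z)
          (at z within {?a..?b})"
    by (rule integral_has_real_derivative) (auto intro: cont)
  then have "((\<lambda>x. Phi ?a + integral {?a..x} std_normal_density) has_real_derivative
      std_normal_density z) (at z)"
    using at_within_Icc_at[of ?a z ?b] by (auto intro!: derivative_eq_intros)
  then show ?thesis
    by (rule has_field_derivative_transform_within_open[where S="{?a<..<?b}"]) (auto simp: eq)
qed

lemma DERIV_Phi_minus:
  "((\<lambda>x. Phi (- x)) has_real_derivative - std_normal_density x) (at x)"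
  using DERIV_chain2[OF DERIV_Phi[of "- x"] DERIV_minus[OF DERIV_ident]]
  by (simp add: normal_density_def)

text \<open>The density is even, so \<open>Phi x + Phi (- x)\<close> has derivative 0. The constant
  is read off from the limits of \<open>Phi\<close> at both infinities.\<close>

lemma Phi_0: "Phi 0 = 1 / 2"
proof -
  have const: "Phi x + Phi (- x) = 2 * Phi 0" for x
    using DERIV_isconst_all[of "\<lambda>x. Phi x + Phi (- x)" x 0]
    by (force intro!: derivative_eq_intros DERIV_Phi DERIV_Phi_minus)
  have "((\<lambda>x. Phi x + Phi (- x)) \<longlongrightarrow> 1 + 0) at_top"
    by (intro tendsto_add Phi_at_top filterlim_compose[OF Phi_at_bot filterlim_uminus_at_bot_at_top])
  then have "2 * Phi 0 = 1 + 0"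
    unfolding const by (metis tendsto_const_iff trivial_limit_at_top_linorder)
  then show ?thesis by simp
qed

subsection \<open>Bounds from alternating series\<close>

definition exp_poly :: "nat \<Rightarrow> real \<Rightarrow> real" where
  "exp_poly N u = (\<Sum>n<N. (- u) ^ n / fact n)"

text \<open>Term-by-term integral of \<open>exp_poly N (t^2 / 2)\<close> over t from 0 to x, hence a
  partial sum of the series of \<open>sqrt (2 * pi) * (Phi x - 1 / 2)\<close>.\<close>

definition erf_poly :: "nat \<Rightarrow> real \<Rightarrow> real" where
  "erf_poly N x = (\<Sum>n<N. (-1) ^ n * x ^ (2 * n + 1) / (2 ^ n * (2 * real n + 1) * fact n))"

text \<open>The Lagrange remainder is a positive multiple of \<open>(- u) ^ N\<close>, so the parity
  of N decides the side of the error.\<close>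

lemma exp_poly_bounds:
  assumes "u \<ge> 0"
  shows "even N \<Longrightarrow> exp_poly N u \<le> exp (- u)" "odd N \<Longrightarrow> exp (- u) \<le> exp_poly N u"
proof -
  obtain t where t: "exp (- u) = exp_poly N u + exp t / fact N * (- u) ^ N"
    using Maclaurin_exp_le[of "- u" N] by (auto simp: exp_poly_def)
  show "even N \<Longrightarrow> exp_poly N u \<le> exp (- u)"
    unfolding t by (simp add: zero_le_even_power)
  show "odd N \<Longrightarrow> exp (- u) \<le> exp_poly N u"
    unfolding t using assms by (simp add: mult_nonneg_nonpos)
qed

lemma DERIV_erf_poly:
  "(erf_poly N has_real_derivative exp_poly N (x\<^sup>2 / 2)) (at x)"
proof -
  have *: "((\<lambda>x. (-1) ^ n * x ^ (2 * n + 1) / (2 ^ n * (2 * real n + 1) * fact n))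
      has_real_derivative (- (x\<^sup>2 / 2)) ^ n / fact n) (at x)" for n
  proof -
    have "((\<lambda>x. (-1) ^ n * x ^ (2 * n + 1) / (2 ^ n * (2 * real n + 1) * fact n))
        has_real_derivative
        (-1) ^ n * (real (2 * n + 1) * x ^ (2 * n)) / (2 ^ n * (2 * real n + 1) * fact n)) (at x)"
      using DERIV_pow[of "2 * n + 1" x UNIV] by (intro DERIV_cdivide DERIV_cmult) simp
    moreover have "(-1) ^ n * (real (2 * n + 1) * x ^ (2 * n)) / (2 ^ n * (2 * real n + 1) * fact n)
        = (-1) ^ n * x ^ (2 * n) / (2 ^ n * fact n)"
    proof -
      have "2 * real n + 1 \<noteq> 0" by linarith
      then show ?thesis by (simp add: divide_simps)
    qed
    moreover have "(- (x\<^sup>2 / 2)) ^ n / fact n = (-1) ^ n * x ^ (2 * n) / (2 ^ n * fact n)"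
      by (simp add: power_minus[of "x\<^sup>2/2"] power_divide power_mult)
    ultimately show ?thesis by simp
  qed
  show ?thesis unfolding erf_poly_def exp_poly_def
    by (rule DERIV_sum) (rule *)
qed

lemma exp_poly_density_bounds:
  fixes x :: real
  defines "k \<equiv> 1 / sqrt (2 * pi)"
  shows "even N \<Longrightarrow> k * exp_poly N (x\<^sup>2 / 2) \<le> std_normal_density x"
    "odd N \<Longrightarrow> std_normal_density x \<le> k * exp_poly N (x\<^sup>2 / 2)"
  using exp_poly_bounds[of "x\<^sup>2/2" N]
  by (auto simp: std_normal_density_def k_def intro!: divide_right_mono)

text \<open>The density bounds are integrated from 0: the sum
  \<open>k * erf_poly N x + Phi (- x)\<close> equals 1/2 at 0, and its derivative is the difference
  between the truncated and the true density, whose sign is fixed by the parity of N.\<close>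

lemma erf_poly_Phi_bounds:
  fixes x :: real
  defines "k \<equiv> 1 / sqrt (2 * pi)"
  assumes "x \<ge> 0"
  shows "even N \<Longrightarrow> Phi (- x) \<le> 1 / 2 - k * erf_poly N x"
    "odd N \<Longrightarrow> 1 / 2 - k * erf_poly N x \<le> Phi (- x)"
proof -
  have deriv: "((\<lambda>x. k * erf_poly N x + Phi (- x)) has_real_derivative
      k * exp_poly N (x\<^sup>2 / 2) - std_normal_density x) (at x)" for x
    by (auto intro!: derivative_eq_intros DERIV_erf_poly DERIV_Phi_minus)
  have zero: "k * erf_poly N 0 + Phi (- 0) = 1 / 2"
    by (simp add: erf_poly_def Phi_0)
  show "Phi (- x) \<le> 1 / 2 - k * erf_poly N x" if "even N"
  proof -
    have "k * erf_poly N x + Phi (- x) \<le> k * erf_poly N 0 + Phi (- 0)"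
    proof (rule DERIV_nonpos_imp_nonincreasing[OF assms(2)])
      show "\<exists>y. ((\<lambda>x. k * erf_poly N x + Phi (- x)) has_real_derivative y) (at z) \<and> y \<le> 0" for z
        using deriv[of z] exp_poly_density_bounds(1)[OF that, of z] unfolding k_def
        by (meson diff_le_0_iff_le)
    qed
    with zero show ?thesis by simp
  qed
  show "1 / 2 - k * erf_poly N x \<le> Phi (- x)" if "odd N"
  proof -
    have "k * erf_poly N 0 + Phi (- 0) \<le> k * erf_poly N x + Phi (- x)"
    proof (rule DERIV_nonneg_imp_nondecreasing[OF assms(2)])
      show "\<exists>y. ((\<lambda>x. k * erf_poly N x + Phi (- x)) has_real_derivative y) (at z) \<and> 0 \<le> y" for z
        using deriv[of z] exp_poly_density_bounds(2)[OF that, of z] unfolding k_def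
        by (meson diff_ge_0_iff_ge)
    qed
    with zero show ?thesis by simp
  qed
qed

section \<open>Rational enclosures of the density and of \<open>Phi\<close> at the bracket
  endpoints\<close>

lemma inverse_sqrt_2pi_bounds:
  "0.39894228 \<le> 1 / sqrt (2 * pi)" "1 / sqrt (2 * pi) \<le> 0.398942281"
proof -
  have "sqrt (2 * pi) \<le> 1 / 0.39894228"
    by (rule real_le_lsqrt) (use pi_approx in \<open>auto simp: power2_eq_square\<close>)
  moreover have "1 / 0.398942281 \<le> sqrt (2 * pi)"
    by (rule real_le_rsqrt) (use pi_approx in \<open>auto simp: power2_eq_square\<close>)
  moreover have "sqrt (2 * pi) > 0" by simp
  ultimately show "0.39894228 \<le> 1 / sqrt (2 * pi)" "1 / sqrt (2 * pi) \<le> 0.398942281"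
    by (simp_all add: field_simps)
qed

text \<open>Here and in the next three lemmas the factor \<open>1 / sqrt (2 * pi)\<close> is
  replaced by a rational on the safe side, which leaves only rational arithmetic. The sign
  conditions make the product monotone in that factor.\<close>

lemma Phi_upper_estimate:
  assumes "even N" "x \<ge> 0" "0 \<le> t" "t \<le> erf_poly N x"
  shows "Phi (- x) \<le> 1 / 2 - 0.39894228 * t"
proof -
  have "0.39894228 * t \<le> 1 / sqrt (2 * pi) * erf_poly N x"
    by (rule mult_mono) (use assms inverse_sqrt_2pi_bounds in auto)
  then show ?thesis using erf_poly_Phi_bounds(1)[of x N] assms by linarith
qed

lemma Phi_lower_estimate:
  assumes "odd N" "x \<ge> 0" "0 \<le> erf_poly N x" "erf_poly N x \<le> t"
  shows "1 / 2 - 0.398942281 * t \<le> Phi (- x)"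
proof -
  have "1 / sqrt (2 * pi) * erf_poly N x \<le> 0.398942281 * t"
    by (rule mult_mono) (use assms inverse_sqrt_2pi_bounds in auto)
  then show ?thesis using erf_poly_Phi_bounds(2)[of x N] assms by linarith
qed

lemma density_lower_estimate:
  assumes "even N" "0 \<le> t" "t \<le> exp_poly N (x\<^sup>2 / 2)"
  shows "0.39894228 * t \<le> std_normal_density x"
proof -
  have "0.39894228 * t \<le> 1 / sqrt (2 * pi) * exp_poly N (x\<^sup>2 / 2)"
    by (rule mult_mono) (use assms inverse_sqrt_2pi_bounds in auto)
  then show ?thesis using exp_poly_density_bounds(1)[of N x] assms by linarith
qed

lemma density_upper_estimate:
  assumes "odd N" "0 \<le> exp_poly N (x\<^sup>2 / 2)" "exp_poly N (x\<^sup>2 / 2) \<le> t"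
  shows "std_normal_density x \<le> 0.398942281 * t"
proof -
  have "1 / sqrt (2 * pi) * exp_poly N (x\<^sup>2 / 2) \<le> 0.398942281 * t"
    by (rule mult_mono) (use assms inverse_sqrt_2pi_bounds in auto)
  then show ?thesis using exp_poly_density_bounds(2)[of N x] assms by linarith
qed

lemmas poly_eval = erf_poly_def exp_poly_def lessThan_nat_numeral lessThan_Suc fact_numeral
  power2_eq_square power_divide

text \<open>Nine terms bound \<open>exp\<close> from above and hence \<open>Phi (- x)\<close> from
  below; eight terms do the opposite. At these arguments the truncation error is below one unit of
  the sixth decimal.\<close>

lemma estimates_rev:
  "0.117023 \<le> Phi (- 1.19)" "Phi (- 1.19) \<le> 0.117024" "std_normal_density 1.19 \<le> 0.196521"
  "0.116826 \<le> Phi (- 1.191)" "Phi (- 1.191) \<le> 0.116827"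
  "0.196286 \<le> std_normal_density 1.191"
  subgoal using Phi_lower_estimate[of 9 "1.19" "erf_poly 9 1.19"] by (simp add: poly_eval)
  subgoal using Phi_upper_estimate[of 8 "1.19" "erf_poly 8 1.19"] by (simp add: poly_eval)
  subgoal using density_upper_estimate[of 9 "1.19" "exp_poly 9 (1.19\<^sup>2 / 2)"]
    by (simp add: poly_eval)
  subgoal using Phi_lower_estimate[of 9 "1.191" "erf_poly 9 1.191"] by (simp add: poly_eval)
  subgoal using Phi_upper_estimate[of 8 "1.191" "erf_poly 8 1.191"] by (simp add: poly_eval)
  subgoal using density_lower_estimate[of 8 "exp_poly 8 (1.191\<^sup>2 / 2)" "1.191"]
    by (simp add: poly_eval)
  done

lemma estimates_nonrev:
  "0.193739 \<le> Phi (- 0.8642)" "Phi (- 0.8642) \<le> 0.19374" "std_normal_density 0.8642 \<le> 0.274623"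
  "0.193711 \<le> Phi (- 0.8643)" "Phi (- 0.8643) \<le> 0.193712" "0.274598 \<le> std_normal_density 0.8643"
  subgoal using Phi_lower_estimate[of 9 "0.8642" "erf_poly 9 0.8642"] by (simp add: poly_eval)
  subgoal using Phi_upper_estimate[of 8 "0.8642" "erf_poly 8 0.8642"] by (simp add: poly_eval)
  subgoal using density_upper_estimate[of 9 "0.8642" "exp_poly 9 (0.8642\<^sup>2 / 2)"]
    by (simp add: poly_eval)
  subgoal using Phi_lower_estimate[of 9 "0.8643" "erf_poly 9 0.8643"] by (simp add: poly_eval)
  subgoal using Phi_upper_estimate[of 8 "0.8643" "erf_poly 8 0.8643"] by (simp add: poly_eval)
  subgoal using density_lower_estimate[of 8 "exp_poly 8 (0.8643\<^sup>2 / 2)" "0.8643"]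
    by (simp add: poly_eval)
  done

lemma Phi_minus_strict_antimono: "x < y \<Longrightarrow> Phi (- y) < Phi (- x)"
  by (rule DERIV_neg_imp_decreasing)
    (use DERIV_Phi_minus normal_density_pos[of 1 0] in fastforce)+

lemma Phi_minus_antimono: "x \<le> y \<Longrightarrow> Phi (- y) \<le> Phi (- x)"
  using Phi_minus_strict_antimono[of x y] by (cases "x = y") auto

subsection \<open>Sign changes of the derivatives\<close>

definition crit_rev :: "real \<Rightarrow> real" where
  "crit_rev x = 2 * Phi (- x) - x * std_normal_density x"

definition crit_nonrev :: "real \<Rightarrow> real" where
  "crit_nonrev x = 2 * Phi (- x) * (1 - 2 * Phi (- x)) - x * std_normal_density x"

lemma DERIV_crit_rev:
  "(crit_rev has_real_derivative (x\<^sup>2 - 3) * std_normal_density x) (at x)"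
  unfolding crit_rev_def[abs_def]
  by (auto intro!: derivative_eq_intros DERIV_Phi_minus DERIV_std_normal_density
      simp: algebra_simps power2_eq_square)

lemma DERIV_crit_nonrev:
  "(crit_nonrev has_real_derivative (x\<^sup>2 - 3 + 8 * Phi (- x)) * std_normal_density x) (at x)"
  unfolding crit_nonrev_def[abs_def]
  by (auto intro!: derivative_eq_intros DERIV_Phi_minus DERIV_std_normal_density
      simp: algebra_simps power2_eq_square)

text \<open>Where \<open>x^2 > 3\<close> the function \<open>crit_rev\<close> increases, so its
  negativity there has to come from the limit at infinity.\<close>

lemma crit_rev_at_top: "(crit_rev \<longlongrightarrow> 0) at_top"
proof -
  have "((\<lambda>x. Phi (- x)) \<longlongrightarrow> 0) at_top"
    by (intro filterlim_compose[OF Phi_at_bot filterlim_uminus_at_bot_at_top])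
  moreover have "((\<lambda>x. x * std_normal_density x) \<longlongrightarrow> 0) at_top"
    unfolding std_normal_density_def by real_asymp
  ultimately have "((\<lambda>x. 2 * Phi (- x) - x * std_normal_density x) \<longlongrightarrow> 2 * 0 - 0) at_top"
    by (intro tendsto_intros)
  then show ?thesis by (simp add: crit_rev_def[abs_def])
qed

lemma crit_rev_pos:
  assumes "0 < x" "x \<le> 1.19"
  shows "crit_rev x > 0"
proof -
  have "crit_rev 1.19 \<le> crit_rev x"
  proof (rule DERIV_nonpos_imp_nonincreasing[OF \<open>x \<le> 1.19\<close>])
    fix z :: real assume "x \<le> z" "z \<le> 1.19"
    then have "z\<^sup>2 \<le> 1.19\<^sup>2" using \<open>0 < x\<close> by (intro power_mono) auto
    then have "(z\<^sup>2 - 3) * std_normal_density z \<le> 0"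
      by (intro mult_nonpos_nonneg) (auto simp: power2_eq_square)
    then show "\<exists>y. (crit_rev has_real_derivative y) (at z) \<and> y \<le> 0"
      using DERIV_crit_rev by blast
  qed
  moreover have "crit_rev 1.19 > 0"
    using estimates_rev unfolding crit_rev_def by simp
  ultimately show ?thesis by linarith
qed

lemma crit_rev_neg:
  assumes "1.191 \<le> x"
  shows "crit_rev x < 0"
proof (cases "x\<^sup>2 \<le> 3")
  case True
  have "crit_rev x \<le> crit_rev 1.191"
  proof (rule DERIV_nonpos_imp_nonincreasing[OF assms])
    fix z :: real assume "1.191 \<le> z" "z \<le> x"
    then have "z\<^sup>2 \<le> x\<^sup>2" by (intro power_mono) auto
    then have "(z\<^sup>2 - 3) * std_normal_density z \<le> 0"
      using True by (intro mult_nonpos_nonneg) auto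
    then show "\<exists>y. (crit_rev has_real_derivative y) (at z) \<and> y \<le> 0"
      using DERIV_crit_rev by blast
  qed
  moreover have "crit_rev 1.191 < 0"
    using estimates_rev unfolding crit_rev_def by simp
  ultimately show ?thesis by linarith
next
  case False
  have mono: "crit_rev y < crit_rev z" if "x \<le> y" "y < z" for y z
  proof (rule DERIV_pos_imp_increasing[OF \<open>y < z\<close>])
    fix w assume "y \<le> w" "w \<le> z"
    then have "x\<^sup>2 \<le> w\<^sup>2" using assms \<open>x \<le> y\<close> by (intro power_mono) auto
    then have "(w\<^sup>2 - 3) * std_normal_density w > 0"
      using False by (intro mult_pos_pos) (auto simp: normal_density_pos)
    then show "\<exists>d. (crit_rev has_real_derivative d) (at w) \<and> d > 0"
      using DERIV_crit_rev by blast
  qed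
  \<comment> \<open>The limit yields only a weak inequality; taking it at \<open>x + 1\<close> and
    using strict growth from x to \<open>x + 1\<close> makes it strict at x.\<close>
  have "crit_rev (x + 1) \<le> 0"
  proof (rule tendsto_lowerbound[OF crit_rev_at_top])
    show "\<forall>\<^sub>F z in at_top. crit_rev (x + 1) \<le> crit_rev z"
      using eventually_gt_at_top[of "x + 1"] by eventually_elim (use mono[of "x + 1"] in force)
  qed simp
  with mono[of x "x + 1"] show ?thesis by simp
qed

text \<open>The factor m of the derivative decreases on the interval. If m is nonnegative at x, then
  \<open>crit_nonrev\<close> has increased from its value 0 at 0 up to x; otherwise it decreases
  from x to 0.8642, where it is still positive.\<close>

lemma crit_nonrev_pos:
  assumes "0 < x" "x \<le> 0.8642"
  shows "crit_nonrev x > 0"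
proof -
  define m where "m = (\<lambda>z. z\<^sup>2 - 3 + 8 * Phi (- z))"
  have deriv: "(crit_nonrev has_real_derivative m z * std_normal_density z) (at z)" for z
    unfolding m_def by (rule DERIV_crit_nonrev)
  have density: "std_normal_density z \<ge> 0.274598" if "0 \<le> z" "z \<le> 0.8642" for z
  proof -
    have "z\<^sup>2 \<le> 0.8643\<^sup>2" using that by (intro power_mono) auto
    then have "std_normal_density 0.8643 \<le> std_normal_density z"
      unfolding std_normal_density_def by (intro mult_left_mono) auto
    then show ?thesis using estimates_nonrev by linarith
  qed
  have anti: "m z < m y" if "0 \<le> y" "y < z" "z \<le> 0.8642" for y z
  proof (rule DERIV_neg_imp_decreasing[OF \<open>y < z\<close>])
    fix w assume "y \<le> w" "w \<le> z"
    have "(m has_real_derivative 2 * w - 8 * std_normal_density w) (at w)"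
      unfolding m_def by (auto intro!: derivative_eq_intros DERIV_Phi_minus)
    \<comment> \<open>Here \<open>2 * w\<close> is at most 1.7284, while eight times the density is
      above 2.19.\<close>
    moreover have "2 * w - 8 * std_normal_density w < 0"
      using density[of w] that \<open>y \<le> w\<close> \<open>w \<le> z\<close> by simp
    ultimately show "\<exists>d. (m has_real_derivative d) (at w) \<and> d < 0" by blast
  qed
  show ?thesis
  proof (cases "m x \<ge> 0")
    case True
    have "crit_nonrev 0 < crit_nonrev x"
    \<comment> \<open>The open version is used because m, and with it the derivative, may vanish at
      x itself.\<close>
    proof (rule DERIV_pos_imp_increasing_open[OF \<open>0 < x\<close>])
      fix z assume "0 < z" "z < x"
      then have "m z * std_normal_density z > 0"
        using anti[of z x] True assms by (intro mult_pos_pos) (auto simp: normal_density_pos)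
      then show "\<exists>d. (crit_nonrev has_real_derivative d) (at z) \<and> d > 0"
        using deriv by blast
    next
      show "continuous_on {0..x} crit_nonrev"
        using deriv DERIV_isCont continuous_at_imp_continuous_on by blast
    qed
    then show ?thesis by (simp add: crit_nonrev_def Phi_0)
  next
    case False
    have "crit_nonrev 0.8642 \<le> crit_nonrev x"
    proof (rule DERIV_nonpos_imp_nonincreasing[OF \<open>x \<le> 0.8642\<close>])
      fix z assume "x \<le> z" "z \<le> 0.8642"
      then have "m z * std_normal_density z \<le> 0"
        using anti[of x z] False assms by (cases "x = z") (auto intro!: mult_nonpos_nonneg)
      then show "\<exists>d. (crit_nonrev has_real_derivative d) (at z) \<and> d \<le> 0"
        using deriv by blast
    qed
    moreover have "crit_nonrev 0.8642 > 0"
    proof -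
      \<comment> \<open>The factors are \<open>2 * 0.193739\<close> and
        \<open>1 - 2 * 0.19374\<close>. The resulting margin over
        \<open>x * std_normal_density x\<close> is only about 9e-6, which is why six decimals are
        required.\<close>
      have "0.387478 * 0.61252 \<le> 2 * Phi (- 0.8642) * (1 - 2 * Phi (- 0.8642))"
        using estimates_nonrev by (intro mult_mono) auto
      then show ?thesis using estimates_nonrev unfolding crit_nonrev_def by simp
    qed
    ultimately show ?thesis by linarith
  qed
qed

text \<open>Up to 1.191 the function decreases from a negative value; from there on it lies below
  \<open>crit_rev\<close>, which is already negative.\<close>

lemma crit_nonrev_neg:
  assumes "0.8643 \<le> x"
  shows "crit_nonrev x < 0"
proof (cases "x \<le> 1.191")
  case True
  have "crit_nonrev x \<le> crit_nonrev 0.8643"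
  proof (rule DERIV_nonpos_imp_nonincreasing[OF assms])
    fix z :: real assume z: "0.8643 \<le> z" "z \<le> x"
    then have "z\<^sup>2 \<le> 1.191\<^sup>2" using True by (intro power_mono) auto
    moreover have "Phi (- z) \<le> Phi (- 0.8643)" by (rule Phi_minus_antimono[OF z(1)])
    \<comment> \<open>Taking \<open>z^2\<close> at the right end and \<open>Phi (- z)\<close> at the
      left end still leaves the first factor at most about -0.03.\<close>
    ultimately have "(z\<^sup>2 - 3 + 8 * Phi (- z)) * std_normal_density z \<le> 0"
      using estimates_nonrev by (intro mult_nonpos_nonneg) (auto simp: power2_eq_square)
    then show "\<exists>y. (crit_nonrev has_real_derivative y) (at z) \<and> y \<le> 0"
      using DERIV_crit_nonrev by blast
  qed
  moreover have "crit_nonrev 0.8643 < 0"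
  proof -
    have "2 * Phi (- 0.8643) * (1 - 2 * Phi (- 0.8643)) \<le> 0.387424 * 0.612578"
      using estimates_nonrev by (intro mult_mono) auto
    then show ?thesis using estimates_nonrev unfolding crit_nonrev_def by simp
  qed
  ultimately show ?thesis by linarith
next
  case False
  then have "crit_rev x < 0" by (intro crit_rev_neg) simp
  moreover have "crit_nonrev x = crit_rev x - (2 * Phi (- x))\<^sup>2"
    by (simp add: crit_rev_def crit_nonrev_def power2_eq_square algebra_simps)
  ultimately show ?thesis using zero_le_power2[of "2 * Phi (- x)"] by linarith
qed

subsection \<open>Location of the maxima\<close>

text \<open>Compactness gives a maximiser of F on the bracket, and the outer comparisons make it
  global. Their strictness confines every maximiser to the bracket. The conclusion
  \<open>F a \<le> F (k * l)\<close> later supplies a lower bound for the maximal value.\<close>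

lemma is_arg_max_bracket:
  fixes f F :: "real \<Rightarrow> real"
  assumes f: "\<And>l. l > 0 \<Longrightarrow> f l = r * F (k * l)" and "r > 0" "k > 0" "0 < a" "a \<le> b"
    and cont: "continuous_on {a..b} F"
    and left: "\<And>x. 0 < x \<Longrightarrow> x < a \<Longrightarrow> F x < F a"
    and right: "\<And>x. b < x \<Longrightarrow> F x < F b"
  shows "\<exists>l. is_arg_max f (\<lambda>l. l > 0) l"
    and "is_arg_max f (\<lambda>l. l > 0) l \<Longrightarrow> a \<le> k * l \<and> k * l \<le> b \<and> F a \<le> F (k * l)"
proof -
  have arg_max_iff: "is_arg_max f (\<lambda>l. l > 0) l \<longleftrightarrow> 0 < l \<and> (\<forall>x>0. F x \<le> F (k * l))" for l
  proof -
    have "(\<forall>y>0. F (k * y) \<le> F (k * l)) \<longleftrightarrow> (\<forall>x>0. F x \<le> F (k * l))"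
    proof safe
      fix x :: real assume *: "\<forall>y>0. F (k * y) \<le> F (k * l)" "x > 0"
      then show "F x \<le> F (k * l)" using *(1)[rule_format, of "x / k"] \<open>k > 0\<close> by simp
    qed (use \<open>k > 0\<close> in auto)
    then show ?thesis using \<open>r > 0\<close> f by (auto simp: is_arg_max_linorder)
  qed
  obtain m where m: "m \<in> {a..b}" "\<And>x. x \<in> {a..b} \<Longrightarrow> F x \<le> F m"
    using continuous_attains_sup[OF _ _ cont] \<open>a \<le> b\<close> by auto
  have "F x \<le> F m" if "x > 0" for x
  proof -
    consider "x < a" | "x \<in> {a..b}" | "b < x" by fastforce
    then show ?thesis
      using left[of x] right[of x] m(2)[of x] m(2)[of a] m(2)[of b] that \<open>a \<le> b\<close>
      by cases auto
  qed
  then have "is_arg_max f (\<lambda>l. l > 0) (m / k)"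
    using m(1) \<open>k > 0\<close> \<open>0 < a\<close> by (simp add: arg_max_iff)
  then show "\<exists>l. is_arg_max f (\<lambda>l. l > 0) l" ..
  show "a \<le> k * l \<and> k * l \<le> b \<and> F a \<le> F (k * l)" if "is_arg_max f (\<lambda>l. l > 0) l"
  proof -
    have max: "0 < k * l" "\<And>x. x > 0 \<Longrightarrow> F x \<le> F (k * l)"
      using that \<open>k > 0\<close> by (auto simp: arg_max_iff)
    show ?thesis
      using max(1) max(2)[of a] max(2)[of b] left[of "k * l"] right[of "k * l"] \<open>0 < a\<close> \<open>a \<le> b\<close>
      by force
  qed
qed

section \<open>The two efficiencies in the variable x = c l / 2\<close>

text \<open>Since \<open>l^2 = 4 * x^2 / c^2\<close>, this is \<open>c^2\<close> times the
  efficiency; the drift term of v vanishes because both directions have equal probability.\<close>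

definition eff_rev :: "real \<Rightarrow> real" where
  "eff_rev x = 8 * x\<^sup>2 * Phi (- x)"

definition eff_nonrev :: "real \<Rightarrow> real" where
  "eff_nonrev x = 4 * x\<^sup>2 * (2 * Phi (- x) / (1 - 2 * Phi (- x)))"

lemma Phi_minus_less_half: "x > 0 \<Longrightarrow> Phi (- x) < 1 / 2"
  using Phi_minus_strict_antimono[of 0 x] Phi_0 by simp

lemma eff_rev_eq: "c > 0 \<Longrightarrow> eff (A_rev c) (B_rev c) l = (1 / c\<^sup>2) * eff_rev ((c / 2) * l)"
  by (simp add: eff_def vol_def flip_def A_rev_def B_rev_def eff_rev_def power2_eq_square)

lemma eff_nonrev_eq:
  assumes "c > 0" "l > 0"
  shows "eff (A_nonrev c) (B_nonrev c) l = (1 / c\<^sup>2) * eff_nonrev ((c / 2) * l)"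
proof -
  define A where "A = 2 * Phi (- ((c / 2) * l))"
  \<comment> \<open>This keeps \<open>1 - A\<close> nonzero, so that v simplifies to
    \<open>A / (1 - A)\<close>.\<close>
  have "A < 1"
    using Phi_minus_less_half[of "(c / 2) * l"] assms by (simp add: A_def)
  then have "A\<^sup>2 / (1 - A) + A = A / (1 - A)"
    by (simp add: field_simps power2_eq_square)
  moreover have "A_nonrev c l = A" by (simp add: A_nonrev_def A_def)
  ultimately have "eff (A_nonrev c) (B_nonrev c) l = l\<^sup>2 * (A / (1 - A))"
    by (simp add: eff_def vol_def flip_def B_nonrev_def)
  then show ?thesis
    using assms unfolding eff_nonrev_def A_def[symmetric] by (simp add: power2_eq_square)
qed

lemma DERIV_eff_rev: "(eff_rev has_real_derivative 8 * x * crit_rev x) (at x)"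
  unfolding eff_rev_def[abs_def] crit_rev_def
  by (auto intro!: derivative_eq_intros DERIV_Phi_minus simp: algebra_simps power2_eq_square)

text \<open>The numerator from the quotient rule collapses to \<open>- 2 * q\<close>, because its
  terms in \<open>p * q\<close> cancel. The point 0 is excluded since the denominator
  \<open>1 - 2 * Phi (- x)\<close> vanishes there.\<close>

lemma DERIV_eff_nonrev:
  assumes "x > 0"
  shows "(eff_nonrev has_real_derivative
    8 * x / (1 - 2 * Phi (- x))\<^sup>2 * crit_nonrev x) (at x)"
proof -
  define p q where "p = Phi (- x)" and "q = std_normal_density x"
  have p: "1 - 2 * p \<noteq> 0" using Phi_minus_less_half[OF assms] by (simp add: p_def)
  have "(eff_nonrev has_real_derivative
      8 * x * (2 * p / (1 - 2 * p)) +
      (- (2 * q) * (1 - 2 * p) - 2 * p * (2 * q)) / (1 - 2 * p)\<^sup>2 * (4 * x\<^sup>2)) (at x)"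
    unfolding eff_nonrev_def[abs_def] p_def q_def
    by (rule derivative_eq_intros DERIV_Phi_minus refl | use p in \<open>simp add: p_def power2_eq_square\<close>)+
  moreover have "8 * x * (2 * p / (1 - 2 * p)) +
      (- (2 * q) * (1 - 2 * p) - 2 * p * (2 * q)) / (1 - 2 * p)\<^sup>2 * (4 * x\<^sup>2) =
      8 * x / (1 - 2 * p)\<^sup>2 * (2 * p * (1 - 2 * p) - x * q)"
    using p by (simp add: divide_simps) (simp add: algebra_simps power2_eq_square)
  ultimately show ?thesis by (simp add: crit_nonrev_def p_def q_def)
qed

text \<open>From above, \<open>x^2\<close> and \<open>Phi (- x)\<close> are bounded at opposite
  ends. From below the same device would give only about 1.3235, short of 1.325, so the comparison
  with the value at 1.19 is used instead.\<close>

lemma eff_rev_bounds: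
  assumes "1.19 \<le> x" "x \<le> 1.191" "eff_rev 1.19 \<le> eff_rev x"
  shows "\<bar>Phi (- x) - 0.117\<bar> \<le> 0.0005" "\<bar>2 * Phi (- x) - 0.234\<bar> \<le> 0.0005"
    "\<bar>eff_rev x - 1.33\<bar> \<le> 0.005"
proof -
  have Phi: "0.116826 \<le> Phi (- x)" "Phi (- x) \<le> 0.117024"
    using Phi_minus_antimono[OF assms(1)] Phi_minus_antimono[OF assms(2)] estimates_rev
    by linarith+
  show "\<bar>Phi (- x) - 0.117\<bar> \<le> 0.0005" using Phi unfolding abs_le_iff by simp
  show "\<bar>2 * Phi (- x) - 0.234\<bar> \<le> 0.0005" using Phi unfolding abs_le_iff by simp
  have "eff_rev x \<le> 8 * 1.191\<^sup>2 * 0.117024"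
    unfolding eff_rev_def using Phi assms by (intro mult_mono power_mono) auto
  moreover have "1.325 \<le> eff_rev 1.19"
    unfolding eff_rev_def using estimates_rev by (simp add: power2_eq_square)
  ultimately show "\<bar>eff_rev x - 1.33\<bar> \<le> 0.005"
    using assms(3) unfolding power2_eq_square abs_le_iff by simp
qed

text \<open>The acceptance rate, about 0.38745, lies close to the rounding boundary 0.3875; this
  forces the narrow bracket, as already at 0.864 the boundary is exceeded.\<close>

lemma eff_nonrev_bounds:
  assumes "0.8642 \<le> x" "x \<le> 0.8643" "eff_nonrev 0.8642 \<le> eff_nonrev x"
  shows "\<bar>2 * Phi (- x) - 0.387\<bar> \<le> 0.0005" "\<bar>eff_nonrev x - 1.89\<bar> \<le> 0.005"
proof -
  have Phi: "0.193711 \<le> Phi (- x)" "Phi (- x) \<le> 0.19374"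
    using Phi_minus_antimono[OF assms(1)] Phi_minus_antimono[OF assms(2)] estimates_nonrev
    by linarith+
  show "\<bar>2 * Phi (- x) - 0.387\<bar> \<le> 0.0005" using Phi unfolding abs_le_iff by simp
  have "eff_nonrev x \<le> 4 * 0.8643\<^sup>2 * (0.38748 / 0.61252)"
    unfolding eff_nonrev_def using Phi assms
    by (intro mult_mono power_mono frac_le) auto
  moreover have "1.885 \<le> eff_nonrev 0.8642"
  proof -
    have "4 * 0.8642\<^sup>2 * (0.387478 / 0.612522) \<le> eff_nonrev 0.8642"
      unfolding eff_nonrev_def using estimates_nonrev
      by (intro mult_mono frac_le) auto
    then show ?thesis by (simp add: power2_eq_square)
  qed
  ultimately show "\<bar>eff_nonrev x - 1.89\<bar> \<le> 0.005"
    using assms(3) unfolding power2_eq_square abs_le_iff by simp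
qed

lemma eff_rev_arg_max:
  assumes "c > 0"
  shows "\<exists>l. is_arg_max (eff (A_rev c) (B_rev c)) (\<lambda>l. l > 0) l"
    and "is_arg_max (eff (A_rev c) (B_rev c)) (\<lambda>l. l > 0) l \<Longrightarrow>
      1.19 \<le> c / 2 * l \<and> c / 2 * l \<le> 1.191 \<and> eff_rev 1.19 \<le> eff_rev (c / 2 * l)"
proof -
  have cont: "continuous_on S eff_rev" for S
    using DERIV_eff_rev DERIV_isCont continuous_at_imp_continuous_on by blast
  have left: "eff_rev x < eff_rev 1.19" if "0 < x" "x < 1.19" for x
  proof (rule DERIV_pos_imp_increasing_open[OF that(2) _ cont])
    fix z assume "x < z" "z < 1.19"
    then have "8 * z * crit_rev z > 0" using crit_rev_pos[of z] that by simp
    then show "\<exists>d. (eff_rev has_real_derivative d) (at z) \<and> d > 0"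
      using DERIV_eff_rev by blast
  qed
  have right: "eff_rev x < eff_rev 1.191" if "1.191 < x" for x
  proof (rule DERIV_neg_imp_decreasing_open[OF that _ cont])
    fix z :: real assume "1.191 < z" "z < x"
    then have "8 * z * crit_rev z < 0" using crit_rev_neg[of z] by (simp add: mult_pos_neg)
    then show "\<exists>d. (eff_rev has_real_derivative d) (at z) \<and> d < 0"
      using DERIV_eff_rev by blast
  qed
  note bracket = is_arg_max_bracket[of "eff (A_rev c) (B_rev c)" "1 / c\<^sup>2" eff_rev "c / 2"
      "1.19" "1.191",
      OF eff_rev_eq[OF assms] _ _ _ _ cont left right]
  show "\<exists>l. is_arg_max (eff (A_rev c) (B_rev c)) (\<lambda>l. l > 0) l"
    using bracket(1) assms by simp
  show "1.19 \<le> c / 2 * l \<and> c / 2 * l \<le> 1.191 \<and> eff_rev 1.19 \<le> eff_rev (c / 2 * l)"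
    if "is_arg_max (eff (A_rev c) (B_rev c)) (\<lambda>l. l > 0) l"
    by (rule bracket(2)) (use assms that in auto)
qed

lemma eff_nonrev_arg_max:
  assumes "c > 0"
  shows "\<exists>l. is_arg_max (eff (A_nonrev c) (B_nonrev c)) (\<lambda>l. l > 0) l"
    and "is_arg_max (eff (A_nonrev c) (B_nonrev c)) (\<lambda>l. l > 0) l \<Longrightarrow>
      0.8642 \<le> c / 2 * l \<and> c / 2 * l \<le> 0.8643 \<and> eff_nonrev 0.8642 \<le> eff_nonrev (c / 2 * l)"
proof -
  \<comment> \<open>The interval must stay away from 0, where the denominator of
    \<open>eff_nonrev\<close> is zero.\<close>
  have cont: "continuous_on {a..b} eff_nonrev" if "a > 0" for a b
    using DERIV_isCont[OF DERIV_eff_nonrev] that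
    by (intro continuous_at_imp_continuous_on) auto
  have factor: "8 * z / (1 - 2 * Phi (- z))\<^sup>2 > 0" if "z > 0" for z
    using Phi_minus_less_half[OF that] that by simp
  have left: "eff_nonrev x < eff_nonrev 0.8642" if "0 < x" "x < 0.8642" for x
  proof (rule DERIV_pos_imp_increasing_open[OF that(2) _ cont[OF that(1)]])
    fix z assume "x < z" "z < 0.8642"
    with that have "z > 0" by simp
    moreover have "8 * z / (1 - 2 * Phi (- z))\<^sup>2 * crit_nonrev z > 0"
      using \<open>z > 0\<close> \<open>z < 0.8642\<close> by (intro mult_pos_pos factor crit_nonrev_pos) auto
    ultimately show "\<exists>d. (eff_nonrev has_real_derivative d) (at z) \<and> d > 0"
      using DERIV_eff_nonrev by blast
  qed
  have right: "eff_nonrev x < eff_nonrev 0.8643" if "0.8643 < x" for x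
  proof (rule DERIV_neg_imp_decreasing_open[OF that _ cont])
    fix z :: real assume "0.8643 < z" "z < x"
    then have "z > 0" by simp
    moreover have "8 * z / (1 - 2 * Phi (- z))\<^sup>2 * crit_nonrev z < 0"
      using \<open>z > 0\<close> \<open>0.8643 < z\<close> by (intro mult_pos_neg factor crit_nonrev_neg) auto
    ultimately show "\<exists>d. (eff_nonrev has_real_derivative d) (at z) \<and> d < 0"
      using DERIV_eff_nonrev by blast
  qed simp
  note bracket = is_arg_max_bracket[of "eff (A_nonrev c) (B_nonrev c)" "1 / c\<^sup>2" eff_nonrev
      "c / 2" "0.8642" "0.8643", OF eff_nonrev_eq[OF assms] _ _ _ _ cont left right]
  show "\<exists>l. is_arg_max (eff (A_nonrev c) (B_nonrev c)) (\<lambda>l. l > 0) l"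
    using bracket(1) assms by simp
  show "0.8642 \<le> c / 2 * l \<and> c / 2 * l \<le> 0.8643 \<and> eff_nonrev 0.8642 \<le> eff_nonrev (c / 2 * l)"
    if "is_arg_max (eff (A_nonrev c) (B_nonrev c)) (\<lambda>l. l > 0) l"
    by (rule bracket(2)) (use assms that in auto)
qed

text \<open>Existence of a maximiser is stated separately, and the estimates are proved for every
  maximiser; thus no particular one has to be selected.\<close>

theorem theorem5:
  fixes c :: real
  assumes "c > 0"
  shows
    "((\<exists>l. is_arg_max (eff (A_rev c) (B_rev c)) (\<lambda>l. l > 0) l) \<and>
      (\<forall>l. is_arg_max (eff (A_rev c) (B_rev c)) (\<lambda>l. l > 0) l \<longrightarrow>
         \<bar>c * l - 2.38\<bar> \<le> 0.005 \<and>
         \<bar>A_rev c l - 0.117\<bar> \<le> 0.0005 \<and>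
         acc_rate (A_rev c) (B_rev c) l = 2 * A_rev c l \<and>
         \<bar>acc_rate (A_rev c) (B_rev c) l - 0.234\<bar> \<le> 0.0005 \<and>
         \<bar>c\<^sup>2 * eff (A_rev c) (B_rev c) l - 1.33\<bar> \<le> 0.005)) \<and>
     ((\<exists>l. is_arg_max (eff (A_nonrev c) (B_nonrev c)) (\<lambda>l. l > 0) l) \<and>
      (\<forall>l. is_arg_max (eff (A_nonrev c) (B_nonrev c)) (\<lambda>l. l > 0) l \<longrightarrow>
         \<bar>c * l - 1.73\<bar> \<le> 0.005 \<and>
         \<bar>acc_rate (A_nonrev c) (B_nonrev c) l - 0.387\<bar> \<le> 0.0005 \<and>
         \<bar>c\<^sup>2 * eff (A_nonrev c) (B_nonrev c) l - 1.89\<bar> \<le> 0.005))"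
proof (intro conjI allI impI)
  show "\<exists>l. is_arg_max (eff (A_rev c) (B_rev c)) (\<lambda>l. l > 0) l"
    by (rule eff_rev_arg_max(1)[OF assms])
  show "\<exists>l. is_arg_max (eff (A_nonrev c) (B_nonrev c)) (\<lambda>l. l > 0) l"
    by (rule eff_nonrev_arg_max(1)[OF assms])
next
  fix l assume "is_arg_max (eff (A_rev c) (B_rev c)) (\<lambda>l. l > 0) l"
  from eff_rev_arg_max(2)[OF assms this]
  have l: "1.19 \<le> c / 2 * l" "c / 2 * l \<le> 1.191" "eff_rev 1.19 \<le> eff_rev (c / 2 * l)"
    by auto
  have A: "A_rev c l = Phi (- (c / 2 * l))" "B_rev c l = Phi (- (c / 2 * l))"
    by (simp_all add: A_rev_def B_rev_def)
  show "\<bar>c * l - 2.38\<bar> \<le> 0.005" using l by (simp add: abs_le_iff)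
  show "\<bar>A_rev c l - 0.117\<bar> \<le> 0.0005" using eff_rev_bounds(1)[OF l] unfolding A by simp
  show "acc_rate (A_rev c) (B_rev c) l = 2 * A_rev c l" by (simp add: acc_rate_def A)
  then show "\<bar>acc_rate (A_rev c) (B_rev c) l - 0.234\<bar> \<le> 0.0005"
    using eff_rev_bounds(2)[OF l] by (simp only: A)
  show "\<bar>c\<^sup>2 * eff (A_rev c) (B_rev c) l - 1.33\<bar> \<le> 0.005"
    using eff_rev_bounds(3)[OF l] assms by (simp add: eff_rev_eq)
next
  fix l assume max: "is_arg_max (eff (A_nonrev c) (B_nonrev c)) (\<lambda>l. l > 0) l"
  then have "l > 0" by (simp add: is_arg_max_def)
  from eff_nonrev_arg_max(2)[OF assms max]
  have l: "0.8642 \<le> c / 2 * l" "c / 2 * l \<le> 0.8643"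
    "eff_nonrev 0.8642 \<le> eff_nonrev (c / 2 * l)"
    by auto
  show "\<bar>c * l - 1.73\<bar> \<le> 0.005" using l by (simp add: abs_le_iff)
  show "\<bar>acc_rate (A_nonrev c) (B_nonrev c) l - 0.387\<bar> \<le> 0.0005"
    using eff_nonrev_bounds(1)[OF l] by (simp add: acc_rate_def A_nonrev_def B_nonrev_def)
  show "\<bar>c\<^sup>2 * eff (A_nonrev c) (B_nonrev c) l - 1.89\<bar> \<le> 0.005"
    using eff_nonrev_bounds(2)[OF l] assms \<open>l > 0\<close> by (simp add: eff_nonrev_eq)
qed

end
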